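(* Fix the number of types $k$ and the type parameters $(v_j,p_j)_{j\in[k]}$ and $(\lambda_j)_{j\in[k]}$. There exists a constant $M_1$ (not depending on $B$ or $T$) such that for every capacity $B$, every horizon $T$ and every arrival vector $\vec A\in[k]^T$, $$\widehat{\mathrm{OPT}}_{\vec A}-\mathcal H_{\vec A}[1]\le M_1,$$ where $\widehat{\mathrm{OPT}}_{\vec A}$ is the clairvoyant general objective and $\mathcal H_{\vec A}[1]$ is the clairvoyant index objective. In particular, $\mathbb E_{\vec A}[\widehat{\mathrm{OPT}}_{\vec A}]\le M_1+\mathbb E_{\vec A}[\mathcal H_{\vec A}[1]]$.
   Context: **Model.** $[k]=\{1,\dots,k\}$, $\mathbb N=\{0,1,2,\dots\}$. There are $k$ customer types; type $j$ has arrival probability $\lambda_j>0$ ($\sum_j\lambda_j=1$), revenue $0\le v_j<1$, and show-up probability $p_j\in\mathbb Q\cap(0,1]$. The critical ratio is $q_j=v_j/p_j$; it is assumed that $q_j<1$ for all $j$. Types are ordered so that $q_1\ge q_2\ge\dots\ge q_k$, and if $q_j=q_{j+1}$ then $v_j>v_{j+1}$ and $p_j>p_{j+1}$. The capacity is $B\in\mathbb N$, the horizon is a positive integer $T$. An arrival vector is $\vec A=(A_1,\dots,A_T)\in[k]^T$; $N_j$ is the number of $t$ with $A_t=j$. When $\vec A$ is random (in $\mathbb E_{\vec A}$), the $A_t$ are i.i.d. with $\mathbb P[A_t=j]=\lambda_j$. For $m\in\mathbb N$, $X_{j,m}\sim \mathrm{Bin}(m,p_j)$, independent across $j$. For $\vec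 x\in\mathbb N^k$ let $V_B(\vec x)=\mathbb E\big[\big(\sum_{j}X_{j,x_j}-B\big)^+\big]$. **Objectives.** $\widehat{\mathrm{OPT}}_{\vec A}$ is the maximum of $\sum_jv_jx_j-V_B(\vec x)$ over all $\vec x\in\mathbb N^k$ with $0\le x_j\le N_j$ for all $j$. $\mathcal H_{\vec A}[1]$ is the maximum of the same function over those feasible $\vec x$ that are *index solutions*, i.e. for which there is $\tilde j\in[k]$ with $x_j=N_j$ for all $j<\tilde j$ and $x_j=0$ for all $j>\tilde j$. *)

theory Defs
  imports "HOL-Probability.Probability"
begin

text \<open>
  Types and periods are indexed by \<open>{1..k}\<close> and \<open>{1..T}\<close>; the values of parameters, arrival vectors
  and acceptance vectors outside these index sets are irrelevant.
\<close>

definition crit_ratio :: "(nat \<Rightarrow> real) \<Rightarrow> (nat \<Rightarrow> real) \<Rightarrow> nat \<Rightarrow> real" where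
  "crit_ratio v p j = v j / p j"

definition num_arrivals :: "nat \<Rightarrow> (nat \<Rightarrow> nat) \<Rightarrow> nat \<Rightarrow> nat" where
  "num_arrivals T A j = card {t \<in> {1..T}. A t = j}"

definition type_pmf :: "nat \<Rightarrow> (nat \<Rightarrow> real) \<Rightarrow> nat pmf" where
  "type_pmf k lam = embed_pmf (\<lambda>j. if j \<in> {1..k} then lam j else 0)"

text \<open>\<^const>\<open>Pi_pmf\<close> is the joint law of independent components; its second argument is the
  dummy value outside the index set.\<close>

definition arrival_pmf :: "nat \<Rightarrow> (nat \<Rightarrow> real) \<Rightarrow> nat \<Rightarrow> (nat \<Rightarrow> nat) pmf" where
  "arrival_pmf k lam T = Pi_pmf {1..T} 0 (\<lambda>_. type_pmf k lam)"

definition showup_pmf :: "nat \<Rightarrow> (nat \<Rightarrow> real) \<Rightarrow> (nat \<Rightarrow> nat) \<Rightarrow> (nat \<Rightarrow> nat) pmf" where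
  "showup_pmf k p x = Pi_pmf {1..k} 0 (\<lambda>j. binomial_pmf (x j) (p j))"

definition overbooking_cost :: "nat \<Rightarrow> (nat \<Rightarrow> real) \<Rightarrow> nat \<Rightarrow> (nat \<Rightarrow> nat) \<Rightarrow> real" where
  "overbooking_cost k p B x =
     measure_pmf.expectation (showup_pmf k p x) (\<lambda>X. max 0 ((\<Sum>j=1..k. real (X j)) - real B))"

definition objective ::
    "nat \<Rightarrow> (nat \<Rightarrow> real) \<Rightarrow> (nat \<Rightarrow> real) \<Rightarrow> nat \<Rightarrow> (nat \<Rightarrow> nat) \<Rightarrow> real" where
  "objective k v p B x = (\<Sum>j=1..k. v j * real (x j)) - overbooking_cost k p B x"

definition feasible :: "nat \<Rightarrow> nat \<Rightarrow> (nat \<Rightarrow> nat) \<Rightarrow> (nat \<Rightarrow> nat) set" where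
  "feasible k T A = (\<Pi>\<^sub>E j\<in>{1..k}. {0..num_arrivals T A j})"

definition is_index_solution :: "nat \<Rightarrow> nat \<Rightarrow> (nat \<Rightarrow> nat) \<Rightarrow> (nat \<Rightarrow> nat) \<Rightarrow> bool" where
  "is_index_solution k T A x \<longleftrightarrow>
     (\<exists>j'\<in>{1..k}. (\<forall>j\<in>{1..k}. j < j' \<longrightarrow> x j = num_arrivals T A j) \<and>
                  (\<forall>j\<in>{1..k}. j > j' \<longrightarrow> x j = 0))"

definition OPT_hat ::
    "nat \<Rightarrow> (nat \<Rightarrow> real) \<Rightarrow> (nat \<Rightarrow> real) \<Rightarrow> nat \<Rightarrow> nat \<Rightarrow> (nat \<Rightarrow> nat) \<Rightarrow> real" where
  "OPT_hat k v p B T A = Max (objective k v p B ` feasible k T A)"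

definition index_OPT ::
    "nat \<Rightarrow> (nat \<Rightarrow> real) \<Rightarrow> (nat \<Rightarrow> real) \<Rightarrow> nat \<Rightarrow> nat \<Rightarrow> (nat \<Rightarrow> nat) \<Rightarrow> real" where
  "index_OPT k v p B T A =
     Max (objective k v p B ` {x \<in> feasible k T A. is_index_solution k T A x})"

lemma pmf_type_pmf:
  assumes "\<And>j. j \<in> {1..k} \<Longrightarrow> lam j > 0" and "(\<Sum>j=1..k. lam j) = 1"
  shows "pmf (type_pmf k lam) j = (if j \<in> {1..k} then lam j else 0)"
  unfolding type_pmf_def
proof (rule pmf_embed_pmf)
  show "0 \<le> (if j \<in> {1..k} then lam j else 0)" for j
    using assms(1)[of j] by (auto simp: less_imp_le)
  have "(\<integral>\<^sup>+ j. ennreal (if j \<in> {1..k} then lam j else 0) \<partial>count_space UNIV)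
      = (\<Sum>j=1..k. ennreal (if j \<in> {1..k} then lam j else 0))"
    by (rule nn_integral_count_space') auto
  also have "\<dots> = (\<Sum>j=1..k. ennreal (lam j))"
    by (rule sum.cong) auto
  also have "\<dots> = ennreal (\<Sum>j=1..k. lam j)"
    using assms(1) by (intro sum_ennreal) (simp add: less_imp_le)
  also have "\<dots> = 1"
    using assms(2) by simp
  finally show "(\<integral>\<^sup>+ j. ennreal (if j \<in> {1..k} then lam j else 0) \<partial>count_space UNIV) = 1" .
qed

lemma finite_feasible: "finite (feasible k T A)"
  unfolding feasible_def by (intro finite_PiE) auto

lemma index_solutions_nonempty:
  assumes "k \<ge> 1"
  shows "{x \<in> feasible k T A. is_index_solution k T A x} \<noteq> {}"
proof -
  have "restrict (\<lambda>_. 0) {1..k} \<in> {x \<in> feasible k T A. is_index_solution k T A x}"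
    using assms by (auto simp: feasible_def is_index_solution_def intro!: bexI[of _ 1])
  then show ?thesis by blast
qed

end

theory Submission
  imports Defs
begin

text \<open>
  Moving expected show-up mass \<open>\<mu>\<close> from type \<open>j\<close> to a type \<open>i < j\<close> gains revenue \<open>(q\<^sub>i - q\<^sub>j) \<mu>\<close>. By
  Jensen's inequality it raises the expected overage by at most the mean absolute deviation of the
  moved mass, hence by at most \<open>\<epsilon> \<mu> + 1 / (4 \<epsilon>)\<close> for every \<open>\<epsilon> > 0\<close>. With \<open>\<epsilon> = q\<^sub>i - q\<^sub>j\<close> a bulk
  exchange therefore loses at most the constant \<open>1 / (4 (q\<^sub>i - q\<^sub>j))\<close>, no matter how large it is. If
  \<open>q\<^sub>i = q\<^sub>j\<close>, then \<open>p\<^sub>i > p\<^sub>j\<close> and the exchange decreases the show-up count in convex order, so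
  nothing is lost. Rationality of the \<open>p\<^sub>j\<close> makes mean-preserving exchanges possible up to bounded
  remainders, and \<open>k - 1\<close> exchanges lead from an optimal solution to an index solution.
\<close>

subsection \<open>Binomial averages of convex functions\<close>

text \<open>If \<open>Y\<close> is binomial with parameters \<open>n\<close> and \<open>p\<close>, then \<open>(bern_avg p ^^ n) f y\<close> is the
  expectation of \<open>f (y + Y)\<close>.\<close>

definition bern_avg :: "real \<Rightarrow> (real \<Rightarrow> real) \<Rightarrow> real \<Rightarrow> real" where
  "bern_avg p f y = (1 - p) * f y + p * f (y + 1)"

lemma bern_avg_0: "bern_avg 0 f = f"
  by (rule ext) (simp add: bern_avg_def)

lemma bern_avg_commute: "bern_avg p (bern_avg q f) = bern_avg q (bern_avg p f)"
  by (rule ext) (simp add: bern_avg_def algebra_simps)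

lemma bern_avg_funpow_commute:
  "(bern_avg p ^^ m) ((bern_avg q ^^ n) f) = (bern_avg q ^^ n) ((bern_avg p ^^ m) f)"
proof -
  have 1: "bern_avg p ((bern_avg q ^^ n) g) = (bern_avg q ^^ n) (bern_avg p g)" for g
    by (induction n) (simp_all add: bern_avg_commute[of p q])
  show ?thesis
    by (induction m) (simp_all add: 1)
qed

lemma bern_avg_mono:
  assumes "0 \<le> p" "p \<le> 1" "f \<le> g"
  shows "bern_avg p f \<le> bern_avg p g"
  using assms unfolding bern_avg_def le_fun_def
  by (auto intro!: add_mono mult_left_mono)

lemma bern_avg_funpow_mono:
  assumes "0 \<le> p" "p \<le> 1" "f \<le> g"
  shows "(bern_avg p ^^ n) f \<le> (bern_avg p ^^ n) g"
  using assms by (induction n) (simp_all add: bern_avg_mono)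

text \<open>Once p + q is fixed, the two-trial average of \<open>f\<close> depends only on p q,
  whose coefficient is the second difference f(y + 2) - 2 f(y + 1) + f(y); midpoint convexity makes
  it nonnegative.\<close>

lemma bern_avg_le_if_sum_eq:
  assumes f: "convex_on UNIV f" and sum: "p + q = p' + q'" and prod: "p * q \<le> p' * q'"
  shows "bern_avg p (bern_avg q f) \<le> bern_avg p' (bern_avg q' f)"
proof (rule le_funI)
  fix y
  have expand: "bern_avg a (bern_avg b f) y
      = f y + (a + b) * (f (y + 1) - f y) + a * b * (f (y + 2) - 2 * f (y + 1) + f y)" for a b
  proof -
    have "y + 1 + 1 = y + 2" by simp
    then show ?thesis unfolding bern_avg_def by (simp only:) (simp add: algebra_simps)
  qed
  have "f ((1 - 1/2) *\<^sub>R y + (1/2) *\<^sub>R (y + 2)) \<le> (1 - 1/2) * f y + (1/2) * f (y + 2)"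
    by (rule convex_onD[OF f]) auto
  moreover have "(1 - 1/2) *\<^sub>R y + (1/2) *\<^sub>R (y + 2) = y + 1"
    by (simp add: field_simps)
  ultimately have "0 \<le> f (y + 2) - 2 * f (y + 1) + f y"
    by simp
  from mult_right_mono[OF prod this] show "bern_avg p (bern_avg q f) y \<le> bern_avg p' (bern_avg q' f) y"
    unfolding expand sum by linarith
qed

section \<open>Convexity, Jensen, second moments and Lipschitz bounds\<close>

lemma convex_on_bern_avg:
  assumes "0 \<le> p" "p \<le> 1" and f: "convex_on UNIV f"
  shows "convex_on UNIV (bern_avg p f)"
proof -
  have "convex_on UNIV (\<lambda>y. f (y + 1))"
  proof (rule convex_onI)
    fix t x y :: real
    assume "0 < t" "t < 1"
    moreover have "(1 - t) *\<^sub>R x + t *\<^sub>R y + 1 = (1 - t) *\<^sub>R (x + 1) + t *\<^sub>R (y + 1)"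
      by (simp add: algebra_simps)
    ultimately show "f ((1 - t) *\<^sub>R x + t *\<^sub>R y + 1) \<le> (1 - t) * f (x + 1) + t * f (y + 1)"
      using convex_onD[OF f, of t "x + 1" "y + 1"] by simp
  qed simp
  with assms show ?thesis
    unfolding bern_avg_def[abs_def] by (intro convex_on_add convex_on_cmul) auto
qed

lemma convex_on_bern_avg_funpow:
  assumes "0 \<le> p" "p \<le> 1" "convex_on UNIV f"
  shows "convex_on UNIV ((bern_avg p ^^ n) f)"
  using assms by (induction n) (simp_all add: convex_on_bern_avg)

text \<open>Jensen's inequality for the binomial law, one trial at a time: with \<open>y\<close>
  arbitrary in the induction, convexity is used only between the two outcomes of a single
  trial.\<close>

lemma bern_avg_funpow_ge_mean:
  assumes p: "0 \<le> p" "p \<le> 1" and f: "convex_on UNIV f"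
  shows "f (y + n * p) \<le> (bern_avg p ^^ n) f y"
proof (induction n arbitrary: y)
  case (Suc n)
  have "f ((1 - p) *\<^sub>R (y + n * p) + p *\<^sub>R (y + 1 + n * p))
      \<le> (1 - p) * f (y + n * p) + p * f (y + 1 + n * p)"
    by (rule convex_onD[OF f]) (use p in auto)
  also have "\<dots> \<le> (1 - p) * (bern_avg p ^^ n) f y + p * (bern_avg p ^^ n) f (y + 1)"
    using p Suc[of y] Suc[of "y + 1"] by (intro add_mono mult_left_mono) auto
  also have "\<dots> = (bern_avg p ^^ Suc n) f y"
    by (simp add: bern_avg_def)
  finally show ?case
    by (simp add: algebra_simps)
qed simp

text \<open>Squared bias plus the variance n p (1 - p); the quadratic serves later as a majorant
  controlling the mean absolute deviation.\<close>

lemma bern_avg_funpow_square: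
  "(bern_avg p ^^ n) (\<lambda>z. a + e * (z - c)\<^sup>2) y = a + e * ((y + n * p - c)\<^sup>2 + n * p * (1 - p))"
proof (induction n arbitrary: y)
  case (Suc n)
  show ?case
    unfolding funpow.simps comp_apply bern_avg_def[of p "(bern_avg p ^^ n) _"] Suc
    by (simp add: power2_eq_square algebra_simps)
qed simp

lemma bern_avg_funpow_lipschitz:
  assumes p: "0 \<le> p" "p \<le> 1" and f: "\<And>x y. \<bar>f x - f y\<bar> \<le> \<bar>x - y\<bar>"
  shows "\<bar>(bern_avg p ^^ n) f x - (bern_avg p ^^ n) f y\<bar> \<le> \<bar>x - y\<bar>"
proof (induction n arbitrary: x y)
  case (Suc n)
  let ?g = "(bern_avg p ^^ n) f"
  have "\<bar>bern_avg p ?g x - bern_avg p ?g y\<bar>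
      = \<bar>(1 - p) * (?g x - ?g y) + p * (?g (x + 1) - ?g (y + 1))\<bar>"
    by (simp add: bern_avg_def algebra_simps)
  also have "\<dots> \<le> \<bar>(1 - p) * (?g x - ?g y)\<bar> + \<bar>p * (?g (x + 1) - ?g (y + 1))\<bar>"
    by (rule abs_triangle_ineq)
  also have "\<dots> = (1 - p) * \<bar>?g x - ?g y\<bar> + p * \<bar>?g (x + 1) - ?g (y + 1)\<bar>"
    using p by (simp add: abs_mult)
  also have "\<dots> \<le> (1 - p) * \<bar>x - y\<bar> + p * \<bar>(x + 1) - (y + 1)\<bar>"
    using p Suc[of x y] Suc[of "x + 1" "y + 1"] by (intro add_mono mult_left_mono) auto
  also have "\<dots> = \<bar>x - y\<bar>"
    by (simp add: algebra_simps)
  finally show ?case by simp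
qed (simp add: f)

text \<open>Each further trial moves the argument by 1 with probability p, so it changes the average
  of a 1-Lipschitz function by at most p.\<close>

lemma bern_avg_funpow_diff:
  assumes p: "0 \<le> p" "p \<le> 1" and f: "\<And>x y. \<bar>f x - f y\<bar> \<le> \<bar>x - y\<bar>"
  shows "\<bar>(bern_avg p ^^ n) f y - f y\<bar> \<le> n * p"
proof (induction n)
  case (Suc n)
  let ?g = "(bern_avg p ^^ n) f"
  have "\<bar>?g (y + 1) - ?g y\<bar> \<le> 1"
    using bern_avg_funpow_lipschitz[OF p f, of n "y + 1" y] by simp
  then have "p * \<bar>?g (y + 1) - ?g y\<bar> \<le> p"
    using p by (simp add: mult_left_le)
  moreover have "(bern_avg p ^^ Suc n) f y - ?g y = p * (?g (y + 1) - ?g y)"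
    by (simp add: bern_avg_def algebra_simps)
  ultimately have "\<bar>(bern_avg p ^^ Suc n) f y - ?g y\<bar> \<le> p"
    using p by (simp add: abs_mult)
  with Suc show ?case
    by (simp add: algebra_simps)
qed simp

text \<open>Both sides are compared with the value of \<open>f\<close> at the common mean
  \<open>c\<close>: a quadratic majorant and variance at most m r bound the left side from above,
  Jensen bounds the right side from below.\<close>

lemma bern_avg_funpow_exchange:
  fixes m n :: nat and r s :: real
  assumes r: "0 \<le> r" "r \<le> 1" and s: "0 \<le> s" "s \<le> 1"
    and f: "convex_on UNIV f" "\<And>x y. \<bar>f x - f y\<bar> \<le> \<bar>x - y\<bar>"
    and mean: "m * r = n * s" and e: "e > 0"
  shows "(bern_avg r ^^ m) f y \<le> (bern_avg s ^^ n) f y + e * (m * r) + 1 / (4 * e)"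
proof -
  define c where "c = y + m * r"
  \<comment> \<open>With d = |z - c|, dividing (2 e d - 1)^2 \<ge> 0 by 4 e gives d \<le> e d^2 +
    1/(4 e).\<close>
  have amgm: "f z \<le> f c + 1 / (4 * e) + e * (z - c)\<^sup>2" for z
  proof -
    have "0 \<le> (2 * e * \<bar>z - c\<bar> - 1)\<^sup>2 / (4 * e)"
      using e by simp
    also have "\<dots> = e * (z - c)\<^sup>2 + 1 / (4 * e) - \<bar>z - c\<bar>"
      using e by (simp add: field_simps power2_eq_square abs_mult_self_eq)
    finally show ?thesis
      using f(2)[of z c] by linarith
  qed
  have "(bern_avg r ^^ m) f y \<le> (bern_avg r ^^ m) (\<lambda>z. (f c + 1 / (4 * e)) + e * (z - c)\<^sup>2) y"
    using bern_avg_funpow_mono[OF r, of f _ m] amgm by (simp add: le_fun_def)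
  also have "\<dots> = f c + 1 / (4 * e) + e * (m * r * (1 - r))"
    unfolding bern_avg_funpow_square by (simp add: c_def)
  also have "\<dots> \<le> f c + 1 / (4 * e) + e * (m * r)"
    using e r by (simp add: mult_left_mono mult_left_le)
  also have "f c \<le> (bern_avg s ^^ n) f y"
    using bern_avg_funpow_ge_mean[OF s f(1), of y n] by (simp add: c_def mean)
  finally show ?thesis by simp
qed

text \<open>The \<open>m\<close> copies of \<open>r\<close> are traded one at a time for copies of \<open>s\<close>, with a single leftover
  probability \<open>t\<close>; every trade keeps the sum of two probabilities and increases their product.\<close>

lemma bern_avg_funpow_spread:
  fixes m n a :: nat and r s :: real
  assumes s: "0 < s" "s \<le> r" and r: "r \<le> 1" and f: "convex_on UNIV f"
    and "0 \<le> t" "t \<le> r" and "m * r + n * s + t = a * s"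
  shows "(bern_avg r ^^ m) ((bern_avg s ^^ n) (bern_avg t f)) \<le> (bern_avg s ^^ a) f"
  using assms(5-)
\<comment> \<open>\<open>a - n\<close> counts the copies of \<open>s\<close> still to be created.
  When none is missing, the mean identity leaves no mass for \<open>r\<close> and
  \<open>t\<close>.\<close>
proof (induction "a - n" arbitrary: m n t)
  case 0
  have "real n * s \<ge> real a * s"
    using 0 s by (intro mult_right_mono) auto
  moreover have "0 \<le> m * r" using s by simp
  ultimately have "m * r = 0" "t = 0" "n * s = a * s"
    using 0 by linarith+
  then have "m = 0" "t = 0" "n = a"
    using s by auto
  then show ?case by (simp add: bern_avg_0)
next
  case (Suc d)
  have r0: "0 \<le> r" and s0: "0 \<le> s" "s \<le> 1"
    using s r by auto
  have d: "d = a - Suc n" using Suc.hyps(2) by simp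
  show ?case
  proof (cases "s \<le> t")
    case True
    \<comment> \<open>The leftover alone yields a copy of \<open>s\<close>: the pair (t, 0) becomes
      (s, t - s), and the product rises from 0.\<close>
    from True s0 have "bern_avg t f \<le> bern_avg s (bern_avg (t - s) f)"
      using bern_avg_le_if_sum_eq[OF f, of t 0 s "t - s"] by (simp add: bern_avg_0)
    then have "(bern_avg r ^^ m) ((bern_avg s ^^ n) (bern_avg t f))
        \<le> (bern_avg r ^^ m) ((bern_avg s ^^ n) (bern_avg s (bern_avg (t - s) f)))"
      using r0 r s0 by (intro bern_avg_funpow_mono)
    also have "\<dots> = (bern_avg r ^^ m) ((bern_avg s ^^ Suc n) (bern_avg (t - s) f))"
      by (simp add: funpow_swap1)
    also have "\<dots> \<le> (bern_avg s ^^ a) f"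
      using Suc.prems True s by (intro Suc.hyps(1)[OF d]) (auto simp: algebra_simps)
    finally show ?thesis .
  next
    case False
    \<comment> \<open>The missing mean is at least s > t, so a copy of \<open>r\<close> must remain
      to be traded.\<close>
    have "real n * s < real a * s \<and> s \<le> real (a - n) * s"
      using Suc.hyps(2) s by (auto intro!: mult_strict_right_mono)
    moreover have "real (a - n) * s = a * s - n * s"
      using Suc.hyps(2) by (simp add: of_nat_diff algebra_simps)
    ultimately have "m * r > 0"
      using Suc.prems False by linarith
    then obtain m' where m: "m = Suc m'"
      by (cases m) auto
    \<comment> \<open>Product condition for trading (r, t) for (s, r + t - s): the products differ
      by (s - t)(r - s).\<close>
    have "r * t \<le> s * (r + t - s)"
    proof -
      have "0 \<le> (s - t) * (r - s)" using False s by simp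
      then show ?thesis by (simp add: algebra_simps)
    qed
    then have "bern_avg r (bern_avg t f) \<le> bern_avg s (bern_avg (r + t - s) f)"
      by (intro bern_avg_le_if_sum_eq[OF f]) auto
    then have "(bern_avg r ^^ m') ((bern_avg s ^^ n) (bern_avg r (bern_avg t f)))
        \<le> (bern_avg r ^^ m') ((bern_avg s ^^ n) (bern_avg s (bern_avg (r + t - s) f)))"
      using r0 r s0 by (intro bern_avg_funpow_mono)
    also have "\<dots> = (bern_avg r ^^ m') ((bern_avg s ^^ Suc n) (bern_avg (r + t - s) f))"
      by (simp add: funpow_swap1)
    also have "\<dots> \<le> (bern_avg s ^^ a) f"
      using Suc.prems False s m by (intro Suc.hyps(1)[OF d]) (auto simp: algebra_simps)
    finally show ?thesis
      using bern_avg_funpow_commute[of n s 1 r] by (simp add: m funpow_swap1)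
  qed
qed

text \<open>Starting without leftover and without copies of \<open>s\<close>: at equal means, the
  binomial law with the larger success probability is smaller in convex order.\<close>

lemma bern_avg_funpow_le:
  fixes m n :: nat and r s :: real
  assumes "0 < s" "s \<le> r" "r \<le> 1" "convex_on UNIV f" "m * r = n * s"
  shows "(bern_avg r ^^ m) f \<le> (bern_avg s ^^ n) f"
  using bern_avg_funpow_spread[of s r f 0 m 0 n] assms by (simp add: bern_avg_0)

subsection \<open>Overbooking cost\<close>

text \<open>Conditioning on one trial is one application of \<open>bern_avg\<close>; the shift
  \<open>y\<close> stays general because a success raises it by 1.\<close>

lemma expectation_binomial_pmf_bern_avg:
  assumes p: "0 \<le> p" "p \<le> 1"
  shows "measure_pmf.expectation (binomial_pmf n p) (\<lambda>m. f (y + real m)) = (bern_avg p ^^ n) f y"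
proof (induction n arbitrary: y)
  case 0
  show ?case using p by (simp add: binomial_pmf_0)
next
  case (Suc n)
  have fin: "finite (set_pmf (binomial_pmf n p))"
    using p by auto
  have "measure_pmf.expectation (binomial_pmf (Suc n) p) (\<lambda>m. f (y + real m))
      = (\<Sum>b\<in>UNIV. pmf (bernoulli_pmf p) b *\<^sub>R
          measure_pmf.expectation (map_pmf ((+) (if b then 1 else 0)) (binomial_pmf n p))
            (\<lambda>m. f (y + real m)))"
    using p fin unfolding map_pmf_def binomial_pmf_Suc[OF atLeastAtMost_iff[THEN iffD2, OF conjI, OF p]]
    by (intro pmf_expectation_bind) auto
  also have "\<dots> = (1 - p) * (bern_avg p ^^ n) f y + p * (bern_avg p ^^ n) f (y + 1)"
    using p Suc[of y] Suc[of "y + 1"] by (simp add: UNIV_bool add.assoc)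
  finally show ?case
    by (simp add: bern_avg_def[of p "(bern_avg p ^^ n) f"])
qed

text \<open>By independence, component \<open>i\<close> can be integrated out first, becoming an
  operator on \<open>f\<close>. The right side keeps the shape of the left, so a second component
  can be removed the same way.\<close>

lemma expectation_Pi_pmf_binomial_remove:
  assumes "finite S" "i \<in> S" and p: "\<forall>j\<in>S. 0 \<le> p j \<and> p j \<le> 1"
  shows "measure_pmf.expectation (Pi_pmf S 0 (\<lambda>j. binomial_pmf (x j) (p j))) (\<lambda>X. f (\<Sum>j\<in>S. real (X j)))
    = measure_pmf.expectation (Pi_pmf (S - {i}) 0 (\<lambda>j. binomial_pmf (x j) (p j)))
        (\<lambda>X. (bern_avg (p i) ^^ x i) f (\<Sum>j\<in>S - {i}. real (X j)))"
proof -
  let ?P = "Pi_pmf (S - {i}) 0 (\<lambda>j. binomial_pmf (x j) (p j))"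
  let ?b = "binomial_pmf (x i) (p i)"
  have pi: "p i \<in> {0..1}" using assms by auto
  have finb: "finite (set_pmf (binomial_pmf (x j) (p j)))" if "j \<in> S" for j
    using p that by auto
  have finP: "finite (set_pmf ?P)"
    using \<open>finite S\<close> finb by (auto simp: set_Pi_pmf intro!: finite_PiE_dflt)
  have "Pi_pmf S 0 (\<lambda>j. binomial_pmf (x j) (p j))
      = Pi_pmf (insert i (S - {i})) 0 (\<lambda>j. binomial_pmf (x j) (p j))"
    using \<open>i \<in> S\<close> by (simp add: insert_absorb)
  also have "\<dots> = ?b \<bind> (\<lambda>y. ?P \<bind> (\<lambda>X. return_pmf (X(i := y))))"
    using \<open>finite S\<close> by (subst Pi_pmf_insert') auto
  \<comment> \<open>\<open>Pi_pmf_insert'\<close> draws component \<open>i\<close> first; swapping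
    the independent draws puts it innermost.\<close>
  also have "\<dots> = ?P \<bind> (\<lambda>X. map_pmf (\<lambda>y. X(i := y)) ?b)"
    unfolding map_pmf_def by (rule bind_commute_pmf)
  finally have decomp: "Pi_pmf S 0 (\<lambda>j. binomial_pmf (x j) (p j))
      = ?P \<bind> (\<lambda>X. map_pmf (\<lambda>y. X(i := y)) ?b)" .
  have "measure_pmf.expectation (Pi_pmf S 0 (\<lambda>j. binomial_pmf (x j) (p j))) (\<lambda>X. f (\<Sum>j\<in>S. real (X j)))
      = (\<Sum>X\<in>set_pmf ?P. pmf ?P X *\<^sub>R
          measure_pmf.expectation (map_pmf (\<lambda>y. X(i := y)) ?b) (\<lambda>X. f (\<Sum>j\<in>S. real (X j))))"
    unfolding decomp using finP finb[OF \<open>i \<in> S\<close>] by (intro pmf_expectation_bind) auto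
  also have "\<dots> = (\<Sum>X\<in>set_pmf ?P. pmf ?P X *\<^sub>R (bern_avg (p i) ^^ x i) f (\<Sum>j\<in>S - {i}. real (X j)))"
  proof (intro sum.cong refl arg_cong[where f = "(*\<^sub>R) _"])
    fix X
    have "(\<Sum>j\<in>S. real ((X(i := y)) j)) = (\<Sum>j\<in>S - {i}. real (X j)) + real y" for y
      using assms by (subst sum.remove[of S i]) auto
    then show "measure_pmf.expectation (map_pmf (\<lambda>y. X(i := y)) ?b) (\<lambda>X. f (\<Sum>j\<in>S. real (X j)))
        = (bern_avg (p i) ^^ x i) f (\<Sum>j\<in>S - {i}. real (X j))"
      using pi by (simp add: expectation_binomial_pmf_bern_avg)
  qed
  also have "\<dots> = measure_pmf.expectation ?P (\<lambda>X. (bern_avg (p i) ^^ x i) f (\<Sum>j\<in>S - {i}. real (X j)))"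
    using finP by (subst integral_measure_pmf[of "set_pmf ?P"]) auto
  finally show ?thesis .
qed

lemma expectation_finite_pmf_mono:
  fixes f g :: "'a \<Rightarrow> real"
  assumes "finite (set_pmf P)" "\<And>x. x \<in> set_pmf P \<Longrightarrow> f x \<le> g x"
  shows "measure_pmf.expectation P f \<le> measure_pmf.expectation P g"
  using assms
  by (intro integral_mono_AE) (auto simp: AE_measure_pmf_iff intro: integrable_measure_pmf_finite)

lemma expectation_finite_pmf_le_add:
  fixes f g :: "'a \<Rightarrow> real"
  assumes "finite (set_pmf P)" "\<And>x. x \<in> set_pmf P \<Longrightarrow> f x \<le> g x + c"
  shows "measure_pmf.expectation P f \<le> measure_pmf.expectation P g + c"
proof -
  have "measure_pmf.expectation P f \<le> measure_pmf.expectation P (\<lambda>x. g x + c)"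
    by (rule expectation_finite_pmf_mono) (use assms in auto)
  also have "\<dots> = measure_pmf.expectation P g + c"
    using assms(1) by (simp add: integrable_measure_pmf_finite)
  finally show ?thesis .
qed

section \<open>The overage function and the cost of changing or exchanging types\<close>

lemma overage_convex_lipschitz:
  fixes B :: real
  shows "convex_on UNIV (\<lambda>y. max 0 (y - B))" and "\<bar>max 0 (x - B) - max 0 (y - B)\<bar> \<le> \<bar>x - y\<bar>"
proof -
  show "convex_on UNIV (\<lambda>y. max 0 (y - B))"
  proof (rule convex_onI)
    fix t x y :: real assume t: "0 < t" "t < 1"
    have "(1 - t) *\<^sub>R x + t *\<^sub>R y - B = (1 - t) * (x - B) + t * (y - B)"
      by (simp add: algebra_simps)
    also have "\<dots> \<le> (1 - t) * max 0 (x - B) + t * max 0 (y - B)"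
      using t by (intro add_mono mult_left_mono) auto
    finally show "max 0 ((1 - t) *\<^sub>R x + t *\<^sub>R y - B) \<le> (1 - t) * max 0 (x - B) + t * max 0 (y - B)"
      using t by (simp add: max_def)
  qed simp
qed (auto simp: max_def)

lemma finite_set_Pi_pmf_binomial:
  assumes "finite S" "\<forall>j\<in>S. 0 \<le> p j \<and> p j \<le> 1"
  shows "finite (set_pmf (Pi_pmf S 0 (\<lambda>j. binomial_pmf (x j) (p j))))"
  using assms by (auto simp: set_Pi_pmf intro!: finite_PiE_dflt finite_set_pmf_binomial_pmf)

lemma overbooking_cost_remove:
  assumes "i \<in> {1..k}" "\<forall>j\<in>{1..k}. 0 \<le> p j \<and> p j \<le> 1"
  shows "overbooking_cost k p B x =
    measure_pmf.expectation (Pi_pmf ({1..k} - {i}) 0 (\<lambda>j. binomial_pmf (x j) (p j)))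
      (\<lambda>X. (bern_avg (p i) ^^ x i) (\<lambda>y. max 0 (y - B)) (\<Sum>j\<in>{1..k} - {i}. real (X j)))"
  unfolding overbooking_cost_def showup_pmf_def
  using assms by (subst expectation_Pi_pmf_binomial_remove[where f = "\<lambda>y. max 0 (y - B)", symmetric]) auto

text \<open>Isolates the two types of an exchange. The law of the others involves neither
  \<open>x i\<close> nor \<open>x j\<close>, so costs before and after can be compared inside one
  expectation.\<close>

lemma overbooking_cost_remove2:
  assumes "i \<in> {1..k}" "j \<in> {1..k}" "i \<noteq> j" "\<forall>j\<in>{1..k}. 0 \<le> p j \<and> p j \<le> 1"
  shows "overbooking_cost k p B x =
    measure_pmf.expectation (Pi_pmf ({1..k} - {i} - {j}) 0 (\<lambda>j. binomial_pmf (x j) (p j)))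
      (\<lambda>X. (bern_avg (p j) ^^ x j) ((bern_avg (p i) ^^ x i) (\<lambda>y. max 0 (y - B)))
        (\<Sum>j\<in>{1..k} - {i} - {j}. real (X j)))"
  unfolding overbooking_cost_remove[OF assms(1,4)]
  by (rule expectation_Pi_pmf_binomial_remove) (use assms in auto)

text \<open>The lower bound is Jensen together with monotonicity of the overage; the upper bound
  holds because n extra units add at most n p \<le> n to the average.\<close>

lemma overbooking_cost_upd:
  assumes i: "i \<in> {1..k}" and p: "\<forall>j\<in>{1..k}. 0 \<le> p j \<and> p j \<le> 1"
  shows "overbooking_cost k p B x \<le> overbooking_cost k p B (x(i := x i + n))"
    and "overbooking_cost k p B (x(i := x i + n)) \<le> overbooking_cost k p B x + n"
proof -
  let ?P = "Pi_pmf ({1..k} - {i}) 0 (\<lambda>j. binomial_pmf (x j) (p j))"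
  let ?f = "\<lambda>y::real. max 0 (y - B)"
  have pi: "0 \<le> p i" "p i \<le> 1" using i p by auto
  have fin: "finite (set_pmf ?P)"
    using p by (intro finite_set_Pi_pmf_binomial) auto
  have P: "Pi_pmf ({1..k} - {i}) 0 (\<lambda>j. binomial_pmf ((x(i := m)) j) (p j)) = ?P" for m
    by (intro Pi_pmf_cong) auto
  have cost: "overbooking_cost k p B (x(i := m)) =
      measure_pmf.expectation ?P (\<lambda>X. (bern_avg (p i) ^^ m) ?f (\<Sum>j\<in>{1..k} - {i}. real (X j)))" for m
    using overbooking_cost_remove[OF i p, where x = "x(i := m)"] unfolding P fun_upd_same .
  note lip = bern_avg_funpow_lipschitz[OF pi overage_convex_lipschitz(2)]
  have step: "?f y \<le> (bern_avg (p i) ^^ n) ?f y" for y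
    using bern_avg_funpow_ge_mean[OF pi overage_convex_lipschitz(1)[of B], of y n] pi
    by (smt (verit) mult_nonneg_nonneg of_nat_0_le_iff)
  have add: "(bern_avg (p i) ^^ (x i + n)) ?f = (bern_avg (p i) ^^ x i) ((bern_avg (p i) ^^ n) ?f)"
    by (simp add: funpow_add)
  \<comment> \<open>Writing \<open>x\<close> as \<open>x(i := x i)\<close> lets \<open>cost\<close>
    express both sides over the same law.\<close>
  have "overbooking_cost k p B (x(i := x i)) \<le> overbooking_cost k p B (x(i := x i + n))"
    unfolding cost add using bern_avg_funpow_mono[OF pi, of ?f "(bern_avg (p i) ^^ n) ?f"] step
    by (intro expectation_finite_pmf_mono[OF fin]) (simp add: le_fun_def)
  then show "overbooking_cost k p B x \<le> overbooking_cost k p B (x(i := x i + n))"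
    by simp
  have "(bern_avg (p i) ^^ (x i + n)) ?f y \<le> (bern_avg (p i) ^^ x i) ?f y + n" for y
  proof -
    have "(bern_avg (p i) ^^ (x i + n)) ?f y = (bern_avg (p i) ^^ n) ((bern_avg (p i) ^^ x i) ?f) y"
      by (simp add: funpow_add add.commute[of "x i"])
    moreover have "\<bar>(bern_avg (p i) ^^ n) ((bern_avg (p i) ^^ x i) ?f) y - (bern_avg (p i) ^^ x i) ?f y\<bar> \<le> n * p i"
      by (rule bern_avg_funpow_diff[OF pi lip])
    moreover have "n * p i \<le> n"
      using pi by (simp add: mult_left_le)
    ultimately show ?thesis by linarith
  qed
  then have "overbooking_cost k p B (x(i := x i + n)) \<le> overbooking_cost k p B (x(i := x i)) + n"
    unfolding cost by (intro expectation_finite_pmf_le_add[OF fin])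
  then show "overbooking_cost k p B (x(i := x i + n)) \<le> overbooking_cost k p B x + n"
    by simp
qed

text \<open>The units of \<open>i\<close> and \<open>j\<close> untouched by the exchange are
  absorbed, with the overage, into one function \<open>g\<close>. It is again convex and
  1-Lipschitz, which is why \<open>swap\<close> ranges over all such functions.\<close>

lemma overbooking_cost_exchange:
  assumes ij: "i \<in> {1..k}" "j \<in> {1..k}" "i \<noteq> j"
    and p: "\<forall>j\<in>{1..k}. 0 \<le> p j \<and> p j \<le> 1"
    and n: "n \<le> x j"
    and swap: "\<And>f y. convex_on UNIV f \<Longrightarrow> (\<And>x y. \<bar>f x - f y\<bar> \<le> \<bar>x - y\<bar>) \<Longrightarrow>
      (bern_avg (p i) ^^ m) f y \<le> (bern_avg (p j) ^^ n) f y + c"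
  shows "overbooking_cost k p B (x(i := x i + m, j := x j - n)) \<le> overbooking_cost k p B x + c"
proof -
  let ?P = "Pi_pmf ({1..k} - {i} - {j}) 0 (\<lambda>j. binomial_pmf (x j) (p j))"
  let ?f = "\<lambda>y::real. max 0 (y - B)"
  let ?x' = "x(i := x i + m, j := x j - n)"
  define g where "g = (bern_avg (p j) ^^ (x j - n)) ((bern_avg (p i) ^^ x i) ?f)"
  have pij: "0 \<le> p i" "p i \<le> 1" "0 \<le> p j" "p j \<le> 1"
    using ij p by auto
  have g: "convex_on UNIV g" "\<bar>g x - g y\<bar> \<le> \<bar>x - y\<bar>" for x y
    unfolding g_def using pij
    by (intro convex_on_bern_avg_funpow bern_avg_funpow_lipschitz overage_convex_lipschitz; simp)+
  have "x j = n + (x j - n)" using n by simp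
  then have old: "(bern_avg (p j) ^^ x j) ((bern_avg (p i) ^^ x i) ?f) = (bern_avg (p j) ^^ n) g"
    unfolding g_def by (metis comp_apply funpow_add)
  have "(bern_avg (p i) ^^ (x i + m)) ?f = (bern_avg (p i) ^^ m) ((bern_avg (p i) ^^ x i) ?f)"
    by (simp add: funpow_add add.commute[of "x i"])
  then have new: "(bern_avg (p j) ^^ ?x' j) ((bern_avg (p i) ^^ ?x' i) ?f) = (bern_avg (p i) ^^ m) g"
    using ij(3) by (simp add: g_def bern_avg_funpow_commute)
  have P: "Pi_pmf ({1..k} - {i} - {j}) 0 (\<lambda>j. binomial_pmf (?x' j) (p j)) = ?P"
    by (intro Pi_pmf_cong) auto
  show ?thesis
    unfolding overbooking_cost_remove2[OF ij p] P old new
    using p by (intro expectation_finite_pmf_le_add finite_set_Pi_pmf_binomial swap g) auto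
qed

section \<open>Effect of exchanges on the objective\<close>

lemma revenue_upd:
  fixes v :: "nat \<Rightarrow> real"
  assumes "i \<in> {1..k}"
  shows "(\<Sum>j=1..k. v j * real ((x(i := a)) j)) = (\<Sum>j=1..k. v j * real (x j)) + v i * (real a - real (x i))"
proof -
  have "(\<Sum>j\<in>{1..k} - {i}. v j * real ((x(i := a)) j)) = (\<Sum>j\<in>{1..k} - {i}. v j * real (x j))"
    by (intro sum.cong) auto
  then show ?thesis
    using sum.remove[OF _ assms, of "\<lambda>j. v j * real (x j)"]
      sum.remove[OF _ assms, of "\<lambda>j. v j * real ((x(i := a)) j)"]
    by (simp add: algebra_simps)
qed

lemma objective_exchange:
  assumes ij: "i \<in> {1..k}" "j \<in> {1..k}" "i \<noteq> j"
    and p: "\<forall>j\<in>{1..k}. 0 < p j \<and> p j \<le> 1"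
    and q: "crit_ratio v p j < crit_ratio v p i \<or> crit_ratio v p j = crit_ratio v p i \<and> p j \<le> p i"
  shows "\<exists>C\<ge>0. \<forall>B x m n. m * p i = n * p j \<longrightarrow> n \<le> x j \<longrightarrow>
    objective k v p B x \<le> objective k v p B (x(i := x i + m, j := x j - n)) + C"
proof -
  have pij: "0 < p i" "p i \<le> 1" "0 < p j" "p j \<le> 1"
    using ij p by auto
  have p': "\<forall>j\<in>{1..k}. 0 \<le> p j \<and> p j \<le> 1"
    using p by auto
  define d where "d = crit_ratio v p i - crit_ratio v p j"
  \<comment> \<open>\<open>C\<close> depends only on the gap \<open>d\<close>. Choosing e =
    \<open>d\<close> makes the term \<open>d * (m * p i)\<close> in the cost bound equal to the
    revenue gain; in a tie the convex order leaves no loss.\<close>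
  define C where "C = (if d > 0 then 1 / (4 * d) else 0)"
  show ?thesis
  proof (intro exI[of _ C] conjI allI impI)
    show "0 \<le> C" by (simp add: C_def)
    fix B x and m n :: nat
    assume mean: "m * p i = n * p j" and n: "n \<le> x j"
    let ?x' = "x(i := x i + m, j := x j - n)"
    have "overbooking_cost k p B ?x' \<le> overbooking_cost k p B x + (d * (m * p i) + C)"
    proof (rule overbooking_cost_exchange[where x = x and n = n, OF ij p' n])
      fix f :: "real \<Rightarrow> real" and y
      assume f: "convex_on UNIV f" "\<And>x y. \<bar>f x - f y\<bar> \<le> \<bar>x - y\<bar>"
      show "(bern_avg (p i) ^^ m) f y \<le> (bern_avg (p j) ^^ n) f y + (d * (m * p i) + C)"
      proof (cases "d > 0")
        case True
        then show ?thesis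
          using bern_avg_funpow_exchange[OF _ pij(2) _ pij(4) f mean True, of y] pij
          by (simp add: C_def)
      next
        case False
        with q have "d = 0" "p j \<le> p i" by (auto simp: d_def)
        then show ?thesis
          using bern_avg_funpow_le[OF pij(3) _ pij(2) f(1) mean] by (simp add: C_def le_fun_def)
      qed
    qed
    moreover have "(\<Sum>j=1..k. v j * real (?x' j))
        = (\<Sum>j=1..k. v j * real (x j)) + d * (m * p i)"
    proof -
      have "(\<Sum>j=1..k. v j * real (?x' j)) = (\<Sum>j=1..k. v j * real (x j)) + (v i * m - v j * n)"
        using revenue_upd[OF ij(2), of v "x(i := x i + m)" "x j - n"] revenue_upd[OF ij(1), of v x "x i + m"] ij(3) n
        by (simp add: algebra_simps of_nat_diff)
      also have "v i * m - v j * n = crit_ratio v p i * (m * p i) - crit_ratio v p j * (n * p j)"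
        using pij by (simp add: crit_ratio_def)
      also have "\<dots> = d * (m * p i)"
        by (simp add: mean d_def algebra_simps)
      finally show ?thesis .
    qed
    ultimately show "objective k v p B x \<le> objective k v p B ?x' + C"
      unfolding objective_def by linarith
  qed
qed

text \<open>This is how rationality enters: \<open>b\<close> units of one type and \<open>a\<close>
  units of the other have exactly the same expected show-ups.\<close>

lemma rational_ratio_obtain:
  fixes r s :: real
  assumes "r \<in> \<rat>" "s \<in> \<rat>" "r > 0" "s > 0"
  obtains a b :: nat where "a > 0" "b > 0" "b * r = a * s"
proof -
  obtain a b where ab: "\<bar>r / s\<bar> = real a / real b" "b \<noteq> 0"
    using Rats_abs_nat_div_natE[OF Rats_divide[OF assms(1,2)]] by metis
  then have "b * r = a * s"
    using assms by (simp add: field_simps)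
  moreover have "a > 0"
    using ab assms by (cases a) auto
  ultimately show thesis
    using ab that by auto
qed

text \<open>Batches of \<open>a\<close> units of \<open>j\<close> are traded for \<open>b\<close>
  units of \<open>i\<close> until less than one batch of supply or of room is left.\<close>

lemma exchange_exhaust:
  assumes ij: "i \<in> {1..k}" "j \<in> {1..k}" "i \<noteq> j"
    and p: "\<forall>j\<in>{1..k}. p j \<in> \<rat> \<and> 0 < p j \<and> p j \<le> 1"
    and q: "crit_ratio v p j < crit_ratio v p i \<or> crit_ratio v p j = crit_ratio v p i \<and> p j \<le> p i"
  shows "\<exists>K C. 0 \<le> C \<and> (\<forall>B N x. x i \<le> N i \<longrightarrow> (\<exists>y. (\<forall>l. l \<noteq> i \<longrightarrow> l \<noteq> j \<longrightarrow> y l = x l) \<and>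
     y i \<le> N i \<and> y j \<le> x j \<and> (y j < K \<or> N i < y i + K) \<and>
     objective k v p B x \<le> objective k v p B y + C))"
proof -
  have "\<forall>j\<in>{1..k}. 0 < p j \<and> p j \<le> 1"
    using p by auto
  from objective_exchange[OF ij this q] obtain C where C: "C \<ge> 0"
    and exch: "\<And>B x m n. m * p i = n * p j \<Longrightarrow> n \<le> x j \<Longrightarrow>
      objective k v p B x \<le> objective k v p B (x(i := x i + m, j := x j - n)) + C"
    by blast
  obtain a b :: nat where ab: "a > 0" "b > 0" "b * p i = a * p j"
    using rational_ratio_obtain[of "p i" "p j"] p ij by metis
  have "\<exists>y. (\<forall>l. l \<noteq> i \<longrightarrow> l \<noteq> j \<longrightarrow> y l = x l) \<and>
     y i \<le> N i \<and> y j \<le> x j \<and> (y j < a + b \<or> N i < y i + (a + b)) \<and>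
     objective k v p B x \<le> objective k v p B y + C" if x: "x i \<le> N i" for B N x
  proof -
    \<comment> \<open>\<open>L\<close> is the largest number of batches that both supply and room
      permit; the binding one leaves a division remainder.\<close>
    define L where "L = min (x j div a) ((N i - x i) div b)"
    let ?y = "x(i := x i + b * L, j := x j - a * L)"
    have "b * L \<le> b * ((N i - x i) div b)" "a * L \<le> a * (x j div a)"
      by (simp_all add: L_def)
    then have le: "b * L \<le> N i - x i" "a * L \<le> x j"
      using times_div_less_eq_dividend[of b "N i - x i"] times_div_less_eq_dividend[of a "x j"]
      by linarith+
    have "x j - a * L < a \<or> N i - x i - b * L < b"
    proof (cases "x j div a \<le> (N i - x i) div b")
      case True
      then have "x j - a * L = x j mod a"
        by (simp add: L_def minus_mult_div_eq_mod)
      then show ?thesis using ab by simp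
    next
      case False
      then have "N i - x i - b * L = (N i - x i) mod b"
        by (simp add: L_def minus_mult_div_eq_mod del: diff_diff_left)
      then show ?thesis using ab by simp
    qed
    moreover have "objective k v p B x \<le> objective k v p B ?y + C"
    proof (rule exch)
      have "real (b * L) * p i = (b * p i) * L" by simp
      then show "real (b * L) * p i = real (a * L) * p j" using ab by simp
    qed (rule le)
    ultimately show ?thesis
      using x le ij(3) by (intro exI[of _ ?y]) auto
  qed
  \<comment> \<open>\<open>a + b\<close> exceeds either remainder, so one constant covers both
    alternatives.\<close>
  with C show ?thesis by (intro exI[of _ "a + b"] exI[of _ C]) blast
qed

subsection \<open>From optimal to index solutions\<close>

text \<open>Per unit, revenue and cost move in the same direction by amounts in [0, 1], so only one
  of them can hurt: the cost when units are added, the revenue when they are removed.\<close>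

lemma objective_upd:
  assumes i: "i \<in> {1..k}" and p: "\<forall>j\<in>{1..k}. 0 \<le> p j \<and> p j \<le> 1" and v: "0 \<le> v i" "v i \<le> 1"
  shows "objective k v p B x \<le> objective k v p B (x(i := m)) + \<bar>real m - real (x i)\<bar>"
proof (cases "x i \<le> m")
  case True
  then obtain n where m: "m = x i + n"
    using le_Suc_ex by blast
  have "0 \<le> v i * real n"
    using v by simp
  then show ?thesis
    using overbooking_cost_upd(2)[OF i p, of B x n] revenue_upd[OF i, of v x m]
    by (simp add: objective_def m)
next
  case False
  then obtain n where n: "x i = m + n"
    using le_Suc_ex[of m "x i"] by auto
  have "v i * real n \<le> real n"
    using v by (simp add: mult_left_le_one_le)
  moreover have "(x(i := m))(i := (x(i := m)) i + n) = x"
    by (simp add: n[symmetric])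
  ultimately show ?thesis
    using overbooking_cost_upd(1)[OF i p, of B "x(i := m)" n] revenue_upd[OF i, of v x m]
    by (simp add: objective_def n)
qed

lemma objective_cong:
  assumes "\<And>j. j \<in> {1..k} \<Longrightarrow> x j = y j"
  shows "objective k v p B x = objective k v p B y"
proof -
  have "showup_pmf k p x = showup_pmf k p y"
    unfolding showup_pmf_def using assms by (intro Pi_pmf_cong) auto
  then show ?thesis
    using assms by (simp add: objective_def overbooking_cost_def)
qed

text \<open>Used to round a nearly index vector at bounded loss. The coordinates of \<open>x\<close>
  are overwritten by those of \<open>y\<close> one at a time.\<close>

lemma objective_lipschitz:
  assumes p: "\<forall>j\<in>{1..k}. 0 \<le> p j \<and> p j \<le> 1" and v: "\<forall>j\<in>{1..k}. 0 \<le> v j \<and> v j \<le> 1"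
  shows "objective k v p B x \<le> objective k v p B y + (\<Sum>j=1..k. \<bar>real (y j) - real (x j)\<bar>)"
proof -
  have "objective k v p B x \<le> objective k v p B (override_on x y S) + (\<Sum>j\<in>S. \<bar>real (y j) - real (x j)\<bar>)"
    if "finite S" "S \<subseteq> {1..k}" for S
    using that
  proof (induction S rule: finite_induct)
    case (insert i S)
    have "objective k v p B (override_on x y S) \<le> objective k v p B ((override_on x y S)(i := y i))
        + \<bar>real (y i) - real (override_on x y S i)\<bar>"
      using insert.prems v by (intro objective_upd p) auto
    then show ?case
      using insert by (simp add: override_on_insert fun_upd_def)
  qed simp
  from this[of "{1..k}"] show ?thesis
    using objective_cong[of k "override_on x y {1..k}" y] by simp
qed

text \<open>Each step exchanges as much as possible from type \<open>j\<close> to type \<open>i\<close>; afterwards either \<open>j\<close> is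
  nearly empty or \<open>i\<close> is nearly full, so the interval \<open>[i, j]\<close> of unsettled types shrinks.\<close>

lemma near_index_solution:
  fixes k :: nat and N :: "nat \<Rightarrow> nat"
  assumes exch: "\<And>i j x. 1 \<le> i \<Longrightarrow> i < j \<Longrightarrow> j \<le> k \<Longrightarrow> x i \<le> N i \<Longrightarrow>
      \<exists>y. (\<forall>l. l \<noteq> i \<longrightarrow> l \<noteq> j \<longrightarrow> y l = x l) \<and> y i \<le> N i \<and> y j \<le> x j \<and>
        (y j < K \<or> N i < y i + K) \<and> F x \<le> F y + (C::real)"
    and "1 \<le> i" "i \<le> j" "j \<le> k" "\<forall>l\<in>{1..k}. x l \<le> N l"
    and "\<forall>l\<in>{1..<i}. N l < x l + K" "\<forall>l\<in>{j<..k}. x l < K"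
  shows "\<exists>y. \<exists>m\<in>{1..k}. (\<forall>l\<in>{1..k}. y l \<le> N l) \<and> (\<forall>l\<in>{1..<m}. N l < y l + K) \<and>
    (\<forall>l\<in>{m<..k}. y l < K) \<and> F x \<le> F y + real (j - i) * C"
  using assms(2-)
proof (induction "j - i" arbitrary: i j x)
  case 0
  then show ?case
    by (intro exI[of _ x] bexI[of _ i]) auto
next
  case (Suc d)
  have ij: "i < j" using Suc.hyps(2) by simp
  have "x i \<le> N i" using Suc.prems by simp
  from exch[of i j x, OF \<open>1 \<le> i\<close> ij \<open>j \<le> k\<close> this]
  obtain y where y: "\<forall>l. l \<noteq> i \<longrightarrow> l \<noteq> j \<longrightarrow> y l = x l" "y i \<le> N i" "y j \<le> x j"
      "y j < K \<or> N i < y i + K" "F x \<le> F y + C"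
    by blast
  have yN: "\<forall>l\<in>{1..k}. y l \<le> N l"
  proof
    fix l assume "l \<in> {1..k}"
    then show "y l \<le> N l"
      using Suc.prems(4) y by (cases "l = i"; cases "l = j") (auto intro: order_trans)
  qed
  have full: "\<forall>l\<in>{1..<i}. N l < y l + K" and empty: "\<forall>l\<in>{j<..k}. y l < K"
    using Suc.prems(5,6) y(1) ij by auto
  consider "y j < K" | "N i < y i + K" using y(4) by blast
  then have "\<exists>z. \<exists>m\<in>{1..k}. (\<forall>l\<in>{1..k}. z l \<le> N l) \<and> (\<forall>l\<in>{1..<m}. N l < z l + K) \<and>
      (\<forall>l\<in>{m<..k}. z l < K) \<and> F y \<le> F z + real d * C"
  proof cases
    case 1
    have "\<forall>l\<in>{j - 1<..k}. y l < K"
    proof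
      fix l assume "l \<in> {j - 1<..k}"
      then show "y l < K" using 1 empty by (cases "l = j") auto
    qed
    moreover have "d = j - 1 - i" using Suc.hyps(2) by simp
    ultimately show ?thesis
      using Suc.hyps(1)[of "j - 1" i y] Suc.prems ij yN full by auto
  next
    case 2
    have "\<forall>l\<in>{1..<Suc i}. N l < y l + K"
      using 2 full by (auto simp: less_Suc_eq)
    moreover have "d = j - Suc i" using Suc.hyps(2) by simp
    ultimately show ?thesis
      using Suc.hyps(1)[of j "Suc i" y] Suc.prems ij yN empty by auto
  qed
  \<comment> \<open>The exchange just made loses one \<open>C\<close>, the shorter interval the
    remaining \<open>d * C\<close>.\<close>
  moreover have "real (j - i) = real d + 1"
    using Suc.hyps(2) by simp
  ultimately show ?case
    using y(5) by (force simp: algebra_simps)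
qed

text \<open>Two losses add up, both independent of \<open>B\<close>, \<open>N\<close> and
  \<open>x\<close>: at most k - 1 exchanges, then rounding at most k coordinates by at most
  \<open>K\<close> each.\<close>

lemma index_solution_gap:
  assumes k: "k \<ge> 1"
    and v: "\<forall>j\<in>{1..k}. 0 \<le> v j \<and> v j \<le> 1"
    and p: "\<forall>j\<in>{1..k}. p j \<in> \<rat> \<and> 0 < p j \<and> p j \<le> 1"
    and q: "\<And>i j. 1 \<le> i \<Longrightarrow> i < j \<Longrightarrow> j \<le> k \<Longrightarrow>
      crit_ratio v p j < crit_ratio v p i \<or> crit_ratio v p j = crit_ratio v p i \<and> p j \<le> p i"
  shows "\<exists>M. \<forall>B N x. (\<forall>j\<in>{1..k}. x j \<le> N j) \<longrightarrow>
    (\<exists>y. \<exists>m\<in>{1..k}. (\<forall>j\<in>{1..k}. y j \<le> N j) \<and> (\<forall>j\<in>{1..<m}. y j = N j) \<and> (\<forall>j\<in>{m<..k}. y j = 0) \<and>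
      objective k v p B x \<le> objective k v p B y + M)"
proof -
  define P where "P = {(i, j). 1 \<le> i \<and> i < j \<and> j \<le> k}"
  have finP: "finite P"
    by (rule finite_subset[of _ "{1..k} \<times> {1..k}"]) (auto simp: P_def)
  \<comment> \<open>The conclusion of \<open>exchange_exhaust\<close> as a predicate, so that its
    constants can be chosen as functions of the pair.\<close>
  define G :: "nat \<times> nat \<Rightarrow> nat \<Rightarrow> real \<Rightarrow> bool" where "G = (\<lambda>(i, j) K C.
    \<forall>B N x. x i \<le> N i \<longrightarrow> (\<exists>y. (\<forall>l. l \<noteq> i \<longrightarrow> l \<noteq> j \<longrightarrow> y l = x l) \<and>
      y i \<le> N i \<and> y j \<le> x j \<and> (y j < K \<or> N i < y i + K) \<and>
      objective k v p B x \<le> objective k v p B y + C))"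
  have "\<exists>K C. 0 \<le> C \<and> G ij K C" if ijP: "ij \<in> P" for ij
  proof -
    obtain i j where ij: "ij = (i, j)" "1 \<le> i" "i < j" "j \<le> k"
      using ijP by (auto simp: P_def)
    have "\<exists>K C. 0 \<le> C \<and> G (i, j) K C"
      unfolding G_def case_prod_conv
      by (rule exchange_exhaust) (use ij p q[OF ij(2-)] in auto)
    then show ?thesis
      by (simp add: ij(1))
  qed
  then obtain Kf Cf where Cf: "\<And>ij. ij \<in> P \<Longrightarrow> 0 \<le> Cf ij" and G: "\<And>ij. ij \<in> P \<Longrightarrow> G ij (Kf ij) (Cf ij)"
    by metis
  \<comment> \<open>Sums over the finite set \<open>P\<close> of nonnegative constants dominate each
    of them, which makes the bounds uniform over all pairs.\<close>
  define K C where "K = (\<Sum>ij\<in>P. Kf ij)" and "C = (\<Sum>ij\<in>P. Cf ij)"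
  have K: "Kf ij \<le> K" and C: "Cf ij \<le> C" if "ij \<in> P" for ij
    unfolding K_def C_def using that finP Cf by (auto intro!: member_le_sum)
  have exch: "\<exists>y. (\<forall>l. l \<noteq> i \<longrightarrow> l \<noteq> j \<longrightarrow> y l = x l) \<and> y i \<le> N i \<and> y j \<le> x j \<and>
      (y j < K \<or> N i < y i + K) \<and> objective k v p B x \<le> objective k v p B y + C"
    if ij: "1 \<le> i" "i < j" "j \<le> k" and x: "x i \<le> N i" for B and N x :: "nat \<Rightarrow> nat" and i j
  proof -
    have P: "(i, j) \<in> P" using ij by (simp add: P_def)
    from G[OF P] x obtain y where y: "\<forall>l. l \<noteq> i \<longrightarrow> l \<noteq> j \<longrightarrow> y l = x l" "y i \<le> N i" "y j \<le> x j"
        "y j < Kf (i, j) \<or> N i < y i + Kf (i, j)"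
        "objective k v p B x \<le> objective k v p B y + Cf (i, j)"
      unfolding G_def case_prod_conv by blast
    have "y j < K \<or> N i < y i + K" "objective k v p B x \<le> objective k v p B y + C"
      using y(4,5) K[OF P] C[OF P] by auto
    with y(1-3) show ?thesis by blast
  qed
  have "\<exists>y. \<exists>m\<in>{1..k}. (\<forall>j\<in>{1..k}. y j \<le> N j) \<and> (\<forall>j\<in>{1..<m}. y j = N j) \<and> (\<forall>j\<in>{m<..k}. y j = 0) \<and>
      objective k v p B x \<le> objective k v p B y + (real (k - 1) * C + real k * real K)"
    if x: "\<forall>j\<in>{1..k}. x j \<le> N j" for B and N x :: "nat \<Rightarrow> nat"
  proof -
    \<comment> \<open>On the initial interval [1, k] no type is settled yet, so both side conditions
      are vacuous.\<close>
    have "\<exists>y. \<exists>m\<in>{1..k}. (\<forall>l\<in>{1..k}. y l \<le> N l) \<and> (\<forall>l\<in>{1..<m}. N l < y l + K) \<and>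
        (\<forall>l\<in>{m<..k}. y l < K) \<and> objective k v p B x \<le> objective k v p B y + real (k - 1) * C"
      by (rule near_index_solution) (use exch k x in auto)
    then obtain y m where y: "m \<in> {1..k}" "\<forall>l\<in>{1..k}. y l \<le> N l" "\<forall>l\<in>{1..<m}. N l < y l + K"
        "\<forall>l\<in>{m<..k}. y l < K" "objective k v p B x \<le> objective k v p B y + real (k - 1) * C"
      by blast
    \<comment> \<open>Rounding: nearly full types are filled, nearly empty ones emptied, and type
      \<open>m\<close> keeps its value.\<close>
    define z where "z l = (if l < m then N l else if l > m then 0 else y l)" for l
    have "(\<Sum>j=1..k. \<bar>real (z j) - real (y j)\<bar>) \<le> (\<Sum>j=1..k. real K)"
    proof (intro sum_mono)
      fix j assume j: "j \<in> {1..k}"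
      consider "j < m" | "j = m" | "j > m" by linarith
      then show "\<bar>real (z j) - real (y j)\<bar> \<le> real K"
      proof cases
        case 1
        then have "N j < y j + K" "y j \<le> N j" using y j by auto
        then show ?thesis using 1 by (simp add: z_def)
      next
        case 3
        then have "y j < K" using y j by auto
        then show ?thesis using 3 by (simp add: z_def)
      qed (simp add: z_def)
    qed
    moreover have "objective k v p B y \<le> objective k v p B z + (\<Sum>j=1..k. \<bar>real (z j) - real (y j)\<bar>)"
      by (rule objective_lipschitz) (use p v in auto)
    ultimately have "objective k v p B x \<le> objective k v p B z + (real (k - 1) * C + real k * real K)"
      using y(5) by simp
    then show ?thesis
      using y(1,2) by (intro exI[of _ z] bexI[of _ m]) (auto simp: z_def)
  qed
  then show ?thesis
    by (intro exI[of _ "real (k - 1) * C + real k * real K"]) blast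
qed

section \<open>Passing to the maxima and to the expectation\<close>

lemma OPT_hat_le_index_OPT:
  assumes "k \<ge> 1"
    and "\<forall>j\<in>{1..k}. 0 \<le> v j \<and> v j \<le> 1"
    and "\<forall>j\<in>{1..k}. p j \<in> \<rat> \<and> 0 < p j \<and> p j \<le> 1"
    and "\<And>i j. 1 \<le> i \<Longrightarrow> i < j \<Longrightarrow> j \<le> k \<Longrightarrow>
      crit_ratio v p j < crit_ratio v p i \<or> crit_ratio v p j = crit_ratio v p i \<and> p j \<le> p i"
  shows "\<exists>M. \<forall>B T A. OPT_hat k v p B T A \<le> index_OPT k v p B T A + M"
proof -
  have "\<exists>M. \<forall>B N x. (\<forall>j\<in>{1..k}. x j \<le> N j) \<longrightarrow>
    (\<exists>y. \<exists>m\<in>{1..k}. (\<forall>j\<in>{1..k}. y j \<le> N j) \<and> (\<forall>j\<in>{1..<m}. y j = N j) \<and> (\<forall>j\<in>{m<..k}. y j = 0) \<and>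
      objective k v p B x \<le> objective k v p B y + M)"
    by (rule index_solution_gap) (use assms in auto)
  then obtain M where gap: "\<forall>B N x. (\<forall>j\<in>{1..k}. x j \<le> N j) \<longrightarrow>
    (\<exists>y. \<exists>m\<in>{1..k}. (\<forall>j\<in>{1..k}. y j \<le> N j) \<and> (\<forall>j\<in>{1..<m}. y j = N j) \<and> (\<forall>j\<in>{m<..k}. y j = 0) \<and>
      objective k v p B x \<le> objective k v p B y + M)" ..
  show ?thesis
  proof (intro exI[of _ M] allI)
    fix B T A
    let ?N = "num_arrivals T A"
    have "feasible k T A \<noteq> {}"
      by (simp add: feasible_def PiE_eq_empty_iff)
    then have "OPT_hat k v p B T A \<in> objective k v p B ` feasible k T A"
      unfolding OPT_hat_def using finite_feasible by (intro Max_in) auto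
    then obtain x where x: "x \<in> feasible k T A" and opt: "OPT_hat k v p B T A = objective k v p B x"
      by auto
    from x have "\<forall>j\<in>{1..k}. x j \<le> ?N j"
      by (auto simp: feasible_def)
    with gap obtain y m where y: "m \<in> {1..k}" "\<forall>j\<in>{1..k}. y j \<le> ?N j" "\<forall>j\<in>{1..<m}. y j = ?N j"
        "\<forall>j\<in>{m<..k}. y j = 0" "objective k v p B x \<le> objective k v p B y + M"
      by blast
    \<comment> \<open>\<open>feasible\<close> is an extensional product, so \<open>y\<close> must be
      undefined outside the index set; the objective ignores those values.\<close>
    let ?y = "restrict y {1..k}"
    have "?y \<in> {x \<in> feasible k T A. is_index_solution k T A x}"
      using y(1-4) by (auto simp: feasible_def is_index_solution_def intro!: bexI[of _ m])
    then have "objective k v p B ?y \<le> index_OPT k v p B T A"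
      unfolding index_OPT_def using finite_feasible by (intro Max_ge) auto
    moreover have "objective k v p B ?y = objective k v p B y"
      by (rule objective_cong) simp
    ultimately show "OPT_hat k v p B T A \<le> index_OPT k v p B T A + M"
      using opt y(5) by simp
  qed
qed

text \<open>Lifts the ordering from neighbours to all pairs: the order by ratio, then by show-up
  probability, is transitive, and equal ratios at the ends force ties all along.\<close>

lemma crit_ratio_strict_or_tie:
  assumes q_order: "\<And>j. j \<in> {1..<k} \<Longrightarrow> crit_ratio v p j \<ge> crit_ratio v p (j + 1)"
    and q_ties: "\<And>j. j \<in> {1..<k} \<Longrightarrow> crit_ratio v p j = crit_ratio v p (j + 1) \<Longrightarrow> p j > p (j + 1)"
    and "1 \<le> i" "i < j" "j \<le> k"
  shows "crit_ratio v p j < crit_ratio v p i \<or> crit_ratio v p j = crit_ratio v p i \<and> p j \<le> p i"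
proof -
  have "Suc i \<le> j" using assms by simp
  then show ?thesis using \<open>j \<le> k\<close>
  proof (induction j rule: dec_induct)
    case base
    then show ?case using q_order[of i] q_ties[of i] assms(3) by force
  next
    case (step n)
    then show ?case using q_order[of n] q_ties[of n] assms(3) by force
  qed
qed

theorem theorem1:
  fixes k :: nat and v p lam :: "nat \<Rightarrow> real"
  assumes lam_pos: "\<And>j. j \<in> {1..k} \<Longrightarrow> lam j > 0"
    and lam_sum: "(\<Sum>j=1..k. lam j) = 1"
    and v_range: "\<And>j. j \<in> {1..k} \<Longrightarrow> 0 \<le> v j \<and> v j < 1"
    and p_range: "\<And>j. j \<in> {1..k} \<Longrightarrow> p j \<in> \<rat> \<and> 0 < p j \<and> p j \<le> 1"
    and q_less: "\<And>j. j \<in> {1..k} \<Longrightarrow> crit_ratio v p j < 1"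
    and q_order: "\<And>j. j \<in> {1..<k} \<Longrightarrow> crit_ratio v p j \<ge> crit_ratio v p (j + 1)"
    and q_ties: "\<And>j. j \<in> {1..<k} \<Longrightarrow> crit_ratio v p j = crit_ratio v p (j + 1) \<Longrightarrow>
                   v j > v (j + 1) \<and> p j > p (j + 1)"
  shows "\<exists>M\<^sub>1::real.
    (\<forall>(B::nat) (T::nat) (A::nat \<Rightarrow> nat). T > 0 \<longrightarrow> A \<in> {1..T} \<rightarrow> {1..k} \<longrightarrow>
        OPT_hat k v p B T A - index_OPT k v p B T A \<le> M\<^sub>1) \<and>
    (\<forall>(B::nat) (T::nat). T > 0 \<longrightarrow>
        measure_pmf.expectation (arrival_pmf k lam T) (OPT_hat k v p B T)
          \<le> M\<^sub>1 + measure_pmf.expectation (arrival_pmf k lam T) (index_OPT k v p B T))"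
proof -
  have k: "k \<ge> 1"
    using lam_sum by (cases k) auto
  have v: "\<forall>j\<in>{1..k}. 0 \<le> v j \<and> v j \<le> 1"
    using v_range by (auto intro: less_imp_le)
  have p: "\<forall>j\<in>{1..k}. p j \<in> \<rat> \<and> 0 < p j \<and> p j \<le> 1"
    using p_range by blast
  have q: "crit_ratio v p j < crit_ratio v p i \<or> crit_ratio v p j = crit_ratio v p i \<and> p j \<le> p i"
    if "1 \<le> i" "i < j" "j \<le> k" for i j
    using crit_ratio_strict_or_tie[of k v p i j] q_order q_ties that by blast
  have "\<exists>M. \<forall>B T A. OPT_hat k v p B T A \<le> index_OPT k v p B T A + M"
    by (rule OPT_hat_le_index_OPT) (use k v p q in auto)
  then obtain M where gap: "OPT_hat k v p B T A \<le> index_OPT k v p B T A + M" for B T A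
    by blast
  \<comment> \<open>Finite support of the arrival law gives integrability, so the pointwise gap
    carries over to expectations.\<close>
  have "set_pmf (type_pmf k lam) \<subseteq> {1..k}"
    using pmf_type_pmf[OF lam_pos lam_sum] by (auto simp: set_pmf_iff split: if_splits)
  then have "finite (set_pmf (type_pmf k lam))"
    by (rule finite_subset) simp
  then have fin: "finite (set_pmf (arrival_pmf k lam T))" for T
    by (auto simp: arrival_pmf_def set_Pi_pmf intro!: finite_PiE_dflt)
  show ?thesis
  proof (intro exI[of _ M] conjI allI impI)
    fix B T A
    show "OPT_hat k v p B T A - index_OPT k v p B T A \<le> M"
      using gap[of B T A] by simp
  next
    fix B T
    show "measure_pmf.expectation (arrival_pmf k lam T) (OPT_hat k v p B T)
        \<le> M + measure_pmf.expectation (arrival_pmf k lam T) (index_OPT k v p B T)"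
      using expectation_finite_pmf_le_add[OF fin, of T "OPT_hat k v p B T" "index_OPT k v p B T" M] gap
      by simp
  qed
qed

end
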